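(* For every positive integer $n$, the map $\chi:\mathfrak{S}_n\to\mathfrak{S}_n$ defined in the context (the "second variant") is injective, and therefore a bijection.
   Context: Notation. $[n]=\{1,\dots,n\}$; permutations are in one-line notation. A run of $\pi\in\mathfrak{S}_n$ is a maximal consecutive decreasing subsequence of its one-line notation; its largest element is a run top and its smallest element a run bottom. $RT$ and $RB$ are the sets of run tops and run bottoms of $\pi$. The multiset of descent views of $\pi$ contains each $v=\pi(j)$ with multiplicity the number of $i\in[n-1]$ such that $\pi(i)>v>\pi(i+1)$ and the run containing $\pi(i),\pi(i+1)$ has a smaller run bottom than the run containing $v$. $\sigma_e=\chi_e(\pi):[n]\setminus RT\to[n]\setminus RB$ denotes the unique bijection whose multiset of inversion bottoms $\{\{\sigma_e(j)\mid i<j,\ \sigma_e(i)>\sigma_e(j)\}\}$ ($i,j$ in the domain) equals the multiset of descent views of $\pi$ which are not run bottoms; it exists and satisfies $\sigma_e(i)>i$ for all $i\in[n]\setminus RT$. For a partial permutation $f$ (an injective map $S\to[n]$ with $S\subseteq[n]$) and $c\in[n]$ not contained in a cycle of $f$, the iterated preimage $f^*(c)$ is the element $s$ such that $f^k(s)=c$ with $k\ge0$ maximal; in particular $f^*(c)=c$ if $c$ is not in the image of $f$. Definition of $\chi$. Given $\pi$, start with the partial permutation $\sigma=\sigma_e$ and with the sequence of runs of $\pi$ in the order in which they occur in $\pi$. The runs remain separate entities even after other runs are removed. While runs remain, iterate: (1) Let $t$ be the smallest run top among the remaining runs. (2) Remove the run containing $t$ from the sequence. (3) If $t$ was the first element of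 what remained of $\pi$ (i.e. its run was the first in the sequence before removal), set $\sigma(t)=\sigma^*(t)$. (4) Otherwise, let $b_1<b_2<\cdots$ be the run bottoms of the runs that remain after the removal in (2), and let $i$ be the index such that $b_i$ is the run bottom left of $t$ (the run bottom of the run that immediately preceded the run of $t$). Let $s_i$ be the $i$-th smallest element of $[n]$, other than $s=\sigma^*(t)$, which is not yet in the image of $\sigma$. Set $\sigma(t)=s_i$. This procedure is well defined. After all runs have been removed, $\sigma$ is a permutation of $[n]$, and $\chi(\pi)=\sigma$. *)

theory Defs
  imports "HOL-Library.Multiset" "HOL-Combinatorics.Permutations"
begin

text \<open>
  A permutation of \<open>{1..n}\<close> is a function \<open>p :: nat \<Rightarrow> nat\<close> with \<open>p permutes {1..n}\<close>;
  a partial permutation is a map \<open>nat \<Rightarrow> nat option\<close>.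
\<close>

definition one_line :: "nat \<Rightarrow> (nat \<Rightarrow> nat) \<Rightarrow> nat list" where
  "one_line n p = map p [1..<n + 1]"

text \<open>
  Splits a list into its maximal consecutive decreasing blocks, from left to right.
  In a run \<open>r\<close> the largest element is \<open>hd r\<close> and the smallest is \<open>last r\<close>.
\<close>

fun runs :: "nat list \<Rightarrow> nat list list" where
  "runs [] = []"
| "runs [x] = [[x]]"
| "runs (x # y # zs) =
     (if x > y then (x # hd (runs (y # zs))) # tl (runs (y # zs))
      else [x] # runs (y # zs))"

definition run_tops :: "nat \<Rightarrow> (nat \<Rightarrow> nat) \<Rightarrow> nat set" where
  "run_tops n p = hd ` set (runs (one_line n p))"

definition run_bottoms :: "nat \<Rightarrow> (nat \<Rightarrow> nat) \<Rightarrow> nat set" where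
  "run_bottoms n p = last ` set (runs (one_line n p))"

definition run_containing :: "nat \<Rightarrow> (nat \<Rightarrow> nat) \<Rightarrow> nat \<Rightarrow> nat list" where
  "run_containing n p v = (THE r. r \<in> set (runs (one_line n p)) \<and> v \<in> set r)"

text \<open>
  Each \<open>v = p j\<close> occurs once for every descent \<open>p i > p (i + 1)\<close> that it views. Since
  \<open>p i > p (i + 1)\<close>, both of these values lie in the run containing \<open>p i\<close>.
\<close>

definition descent_views :: "nat \<Rightarrow> (nat \<Rightarrow> nat) \<Rightarrow> nat multiset" where
  "descent_views n p =
     image_mset (\<lambda>(i, j). p j)
       (mset_set {(i, j). i \<in> {1..<n} \<and> j \<in> {1..n} \<and> p i > p j \<and> p j > p (i + 1) \<and>
          last (run_containing n p (p i)) < last (run_containing n p (p j))})"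

definition inversion_bottoms :: "(nat \<Rightarrow> nat option) \<Rightarrow> nat multiset" where
  "inversion_bottoms f =
     image_mset (\<lambda>(i, j). the (f j))
       (mset_set {(i, j). i \<in> dom f \<and> j \<in> dom f \<and> i < j \<and> the (f i) > the (f j)})"

definition chi_e :: "nat \<Rightarrow> (nat \<Rightarrow> nat) \<Rightarrow> nat \<Rightarrow> nat option" where
  "chi_e n p = (THE f.
     dom f = {1..n} - run_tops n p \<and> ran f = {1..n} - run_bottoms n p \<and> inj_on f (dom f) \<and>
     inversion_bottoms f = filter_mset (\<lambda>v. v \<notin> run_bottoms n p) (descent_views n p))"

definition partial_pow :: "(nat \<Rightarrow> nat option) \<Rightarrow> nat \<Rightarrow> nat \<Rightarrow> nat option" where
  "partial_pow f k s = ((\<lambda>x. Option.bind x f) ^^ k) (Some s)"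

text \<open>The iterated preimage \<open>f\<^sup>*(c)\<close>, for \<open>c\<close> not contained in a cycle of \<open>f\<close>.\<close>

definition iterated_preimage :: "(nat \<Rightarrow> nat option) \<Rightarrow> nat \<Rightarrow> nat" where
  "iterated_preimage f c = (THE s. \<exists>k. partial_pow f k s = Some c \<and>
     (\<forall>k' s'. partial_pow f k' s' = Some c \<longrightarrow> k' \<le> k))"

text \<open>
  The state of the procedure is the sequence \<open>rs\<close> of remaining runs together with the current
  partial permutation \<open>f\<close>. Since run tops are distinct, \<open>rest\<close> is \<open>rs\<close> without the run of \<open>t\<close>,
  and \<open>left\<close> consists of the remaining runs to the left of that run. The index \<open>i\<close> is
  counted from 1, so \<open>b = b\<^sub>i\<close> is the \<open>i\<close>-th smallest bottom of \<open>rest\<close>, whereas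
  list indexing with \<open>!\<close> starts at 0.
\<close>

function chi_procedure ::
    "nat \<Rightarrow> nat list list \<Rightarrow> (nat \<Rightarrow> nat option) \<Rightarrow> nat \<Rightarrow> nat option" where
  "chi_procedure n rs f =
     (if rs = [] then f
      else
        let t = Min (hd ` set rs);
            rest = filter (\<lambda>r. hd r \<noteq> t) rs;
            left = takeWhile (\<lambda>r. hd r \<noteq> t) rs;
            s = iterated_preimage f t
        in if left = [] then chi_procedure n rest (f(t \<mapsto> s))
           else
             let b = last (last left);
                 i = card {b' \<in> last ` set rest. b' \<le> b};
                 s_i = sorted_list_of_set ({1..n} - {s} - ran f) ! (i - 1)
             in chi_procedure n rest (f(t \<mapsto> s_i)))"
  by pat_completeness auto

lemma length_remove_min_top:
  assumes "rs \<noteq> []"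
  shows "length (filter (\<lambda>r. hd r \<noteq> Min (hd ` set rs)) rs) < length rs"
proof -
  have "Min (hd ` set rs) \<in> hd ` set rs"
    using assms by (intro Min_in) auto
  then obtain r where "r \<in> set rs" "\<not> hd r \<noteq> Min (hd ` set rs)"
    by force
  then show ?thesis
    by (rule length_filter_less)
qed

termination
  by (relation "measure (\<lambda>(n, rs, f). length rs)") (auto simp: length_remove_min_top)

declare chi_procedure.simps [simp del]

text \<open>
  The final partial permutation, extended by the identity outside its domain \<open>{1..n}\<close>
  as required by \<^const>\<open>permutes\<close>.
\<close>

definition chi :: "nat \<Rightarrow> (nat \<Rightarrow> nat) \<Rightarrow> nat \<Rightarrow> nat" where
  "chi n p = (\<lambda>x. case chi_procedure n (runs (one_line n p)) (chi_e n p) x of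
     None \<Rightarrow> x | Some y \<Rightarrow> y)"

end

theory Submission
  imports Defs
begin

text \<open>
  A permutation \<open>p\<close> is the concatenation of its runs, so it is enough to recover the sequence of
  runs from \<open>\<sigma> = chi n p\<close>. Three observations do this.

  First, the run tops of \<open>p\<close> are exactly the \<open>x\<close> with \<open>\<sigma> x \<le> x\<close> (lemma \<open>run_tops_chi\<close>). The values
  off the run tops are strict excedances: fewer inversions are prescribed above \<open>v\<close> than
  there are runs passing over \<open>v\<close>, so some position below \<open>v\<close> is left for it
  (\<open>views_bound\<close>, \<open>few_inversions_imp_excedance\<close>). The values at run tops do not exceed their argument,
  because, up to any bound that is at least the current top \<open>t\<close>, there are as many values not yet
  attained as bottoms of remaining runs: as the bottom left of \<open>t\<close> is below \<open>t\<close>, so is the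
  value of the same index (\<open>min_top_removal.new_image\<close>, \<open>min_top_removal.state_step\<close>).
  Consequently \<open>\<sigma>\<close> determines \<open>chi_e n p\<close>, its restriction to the strict excedances, and thereby
  also the run bottoms and the numbers of views.

  Secondly, these data determine the set of runs (\<open>views_determine_runs\<close>). Sweep the values
  upwards. At a value \<open>v\<close> that is not a bottom some runs are open, and the number of views of
  \<open>v\<close> says how many of the open runs have a smaller bottom than the run of \<open>v\<close>.

  Thirdly, once the set of runs is known, replaying the procedure on two arrangements of it
  removes the same run at each step, and the value assigned to its top reveals the run
  to its left, or that there is none (\<open>chi_procedure_inject\<close>).

  All this presupposes that \<open>chi_e n p\<close> exists and is unique. Counting, for each value, the larger
  values before it is a Lehmer code of an injection, and codes within the evident
  bounds correspond to exactly one injection (\<open>ex_map_with_inversions\<close>, \<open>map_eqI_inversions\<close>).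
\<close>

section \<open>Ranks in finite sets\<close>

lemma rank_inject:
  fixes S :: "'a::linorder set"
  assumes "finite S" "x \<in> S" "y \<in> S" "card {z \<in> S. z < x} = card {z \<in> S. z < y}"
  shows "x = y"
proof (rule ccontr)
  have less: "card {z \<in> S. z < a} < card {z \<in> S. z < b}" if "a \<in> S" "a < b" for a b
    using assms(1) that by (intro psubset_card_mono) auto
  assume "x \<noteq> y"
  then show False
    using less[of x y] less[of y x] assms by (cases x y rule: linorder_cases) auto
qed

lemma rank_le_inject:
  fixes S :: "'a::linorder set"
  assumes "finite S" "x \<in> S" "y \<in> S" "card {z \<in> S. z \<le> x} = card {z \<in> S. z \<le> y}"
  shows "x = y"
proof -
  have "card {z \<in> S. z \<le> a} = Suc (card {z \<in> S. z < a})" if "a \<in> S" for a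
  proof -
    have "{z \<in> S. z \<le> a} = insert a {z \<in> S. z < a}" using that by auto
    then show ?thesis using assms(1) by simp
  qed
  then show ?thesis using assms rank_inject[of S x y] by simp
qed

lemma ex_element_of_rank:
  fixes S :: "'a::linorder set"
  assumes "finite S" "k < card S"
  shows "\<exists>a\<in>S. card {z \<in> S. z < a} = k"
proof -
  let ?rank = "\<lambda>a. card {z \<in> S. z < a}"
  have "inj_on ?rank S"
    using assms(1) by (intro inj_onI) (rule rank_inject)
  moreover have "?rank ` S \<subseteq> {..<card S}"
    using assms(1) by (auto intro!: psubset_card_mono)
  ultimately have "?rank ` S = {..<card S}"
    by (intro card_subset_eq) (auto simp: card_image)
  then show ?thesis
    using assms(2) by (metis (no_types, lifting) imageE lessThan_iff)
qed

lemma nth_sorted_list_of_set_le: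
  fixes S :: "'a::linorder set"
  assumes "finite S" "k < card {x \<in> S. x \<le> t}"
  shows "sorted_list_of_set S ! k \<le> t"
proof (rule ccontr)
  let ?L = "sorted_list_of_set S"
  assume "\<not> ?L ! k \<le> t"
  then have big: "t < ?L ! k" by simp
  have "{x \<in> S. x \<le> t} \<subseteq> set (take k ?L)"
  proof
    fix x assume "x \<in> {x \<in> S. x \<le> t}"
    then have "x \<in> set ?L" "x \<le> t" using assms(1) by auto
    then obtain j where j: "j < length ?L" "x = ?L ! j"
      by (metis in_set_conv_nth)
    have "j < k"
    proof (rule ccontr)
      assume "\<not> j < k"
      then have "?L ! k \<le> ?L ! j"
        using j(1) by (intro sorted_nth_mono) auto
      then show False using big j(2) \<open>x \<le> t\<close> by simp
    qed
    then show "x \<in> set (take k ?L)"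
      using j by (auto simp: in_set_conv_nth)
  qed
  then have "card {x \<in> S. x \<le> t} \<le> card (set (take k ?L))"
    by (intro card_mono) auto
  also have "\<dots> \<le> k"
    using card_length[of "take k ?L"] by simp
  finally show False using assms(2) by simp
qed

section \<open>Runs\<close>

text \<open>
  The last condition says that consecutive blocks cannot be merged. It survives the removal of the
  run with the smallest top, which is how the procedure uses it.
\<close>

definition run_sequence :: "nat list list \<Rightarrow> bool" where
  "run_sequence rs \<longleftrightarrow>
     (\<forall>r\<in>set rs. r \<noteq> [] \<and> sorted_wrt (>) r) \<and> distinct (concat rs) \<and>
     successively (\<lambda>r q. last r < hd q) rs"

lemma runs_Cons: "\<exists>r rs. runs (x # xs) = (x # r) # rs"
proof (induction xs arbitrary: x)
  case (Cons y xs)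
  then show ?case using Cons[of y] by auto
qed simp

lemma concat_runs: "concat (runs xs) = xs"
proof (induction xs rule: runs.induct)
  case (3 x y zs)
  obtain r rs where "runs (y # zs) = (y # r) # rs"
    using runs_Cons by blast
  then show ?case using 3 by (cases "x > y") auto
qed simp_all

lemma run_decreasing: "r \<in> set (runs xs) \<Longrightarrow> r \<noteq> [] \<and> sorted_wrt (>) r"
proof (induction xs arbitrary: r rule: runs.induct)
  case (3 x y zs)
  obtain r' rs where eq: "runs (y # zs) = (y # r') # rs"
    using runs_Cons by blast
  show ?case
  proof (cases "x > y")
    case True
    then have "sorted_wrt (>) (y # r')"
      using "3.IH"(1)[of "y # r'"] eq by simp
    then have "sorted_wrt (>) (x # y # r')"
      using True by auto
    then show ?thesis
      using "3.IH"(1)[of r] "3.prems" True eq by auto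
  next
    case False
    then show ?thesis using "3.IH"(3)[of r] "3.prems" eq by auto
  qed
qed simp_all

lemma successively_runs:
  "distinct xs \<Longrightarrow> successively (\<lambda>r q. last r < hd q) (runs xs)"
proof (induction xs rule: runs.induct)
  case (3 x y zs)
  obtain r rs where eq: "runs (y # zs) = (y # r) # rs"
    using runs_Cons by blast
  show ?case
  proof (cases "x > y")
    case True
    then show ?thesis using "3.IH"(1) "3.prems" eq by (cases rs) auto
  next
    case False
    then have "x < y" using "3.prems" by auto
    then show ?thesis using "3.IH"(3) "3.prems" False eq by auto
  qed
qed simp_all

lemma run_sequence_runs: "distinct xs \<Longrightarrow> run_sequence (runs xs)"
  by (simp add: run_sequence_def concat_runs run_decreasing successively_runs)

lemma sorted_wrt_greater_bounds:
  fixes r :: "nat list"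
  assumes "sorted_wrt (>) r" "x \<in> set r"
  shows "last r \<le> x" "x \<le> hd r"
proof -
  show "x \<le> hd r"
    using assms by (cases r) auto
  have "r = butlast r @ [last r]"
    using assms(2) by (cases r) auto
  then have "sorted_wrt (>) (butlast r @ [last r])" "x \<in> set (butlast r @ [last r])"
    using assms by metis+
  then show "last r \<le> x"
    by (auto simp: sorted_wrt_append)
qed

lemma run_sequence_bounds:
  assumes "run_sequence rs" "r \<in> set rs" "x \<in> set r"
  shows "last r \<le> x" "x \<le> hd r"
  using assms sorted_wrt_greater_bounds by (auto simp: run_sequence_def)

lemma run_sequence_mem:
  assumes "run_sequence rs" "r \<in> set rs"
  shows "hd r \<in> set r" "last r \<in> set r" "last r \<le> hd r"
proof -
  have "r \<noteq> []" using assms by (auto simp: run_sequence_def)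
  then show "hd r \<in> set r" "last r \<in> set r" by auto
  then show "last r \<le> hd r" using run_sequence_bounds assms by blast
qed

lemma run_sequence_ends:
  assumes "run_sequence rs"
  shows "hd ` set rs \<subseteq> set (concat rs)" "last ` set rs \<subseteq> set (concat rs)"
  using run_sequence_mem[OF assms] by fastforce+

lemma run_sequence_disjoint:
  assumes "run_sequence rs" "r \<in> set rs" "q \<in> set rs" "x \<in> set r" "x \<in> set q"
  shows "r = q"
  using assms unfolding run_sequence_def distinct_concat_iff by blast

lemma run_sequence_distinct: "run_sequence rs \<Longrightarrow> distinct rs"
  by (auto simp: run_sequence_def distinct_concat_iff removeAll_id)

lemma run_sequence_inj:
  assumes "run_sequence rs"
  shows "inj_on hd (set rs)" "inj_on last (set rs)"
  using run_sequence_mem[OF assms] run_sequence_disjoint[OF assms]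
  by (metis inj_onI)+

definition run_of :: "nat list set \<Rightarrow> nat \<Rightarrow> nat list" where
  "run_of R v = (THE r. r \<in> R \<and> v \<in> set r)"

lemma run_of_eq:
  assumes "run_sequence rs" "r \<in> set rs" "v \<in> set r"
  shows "run_of (set rs) v = r"
  unfolding run_of_def using assms by (blast intro: the_equality dest: run_sequence_disjoint)

lemma run_of_mem:
  assumes "run_sequence rs" "v \<in> set (concat rs)"
  shows "run_of (set rs) v \<in> set rs" "v \<in> set (run_of (set rs) v)"
  using assms run_of_eq by auto

lemma runs_one_line:
  assumes "p permutes {1..n}"
  shows "run_sequence (runs (one_line n p))" "set (concat (runs (one_line n p))) = {1..n}"
proof -
  have "inj p" using assms by (rule permutes_inj)
  then have "distinct (one_line n p)"
    by (auto simp: one_line_def distinct_map intro: inj_on_subset)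
  then show "run_sequence (runs (one_line n p))" by (rule run_sequence_runs)
  have "set (one_line n p) = p ` {1..n}"
    by (auto simp: one_line_def atLeastLessThanSuc_atLeastAtMost simp del: upt_Suc)
  then show "set (concat (runs (one_line n p))) = {1..n}"
    unfolding concat_runs using permutes_image[OF assms] by simp
qed

section \<open>Descent views, run by run\<close>

text \<open>
  A decreasing run steps over a value outside it exactly once if that value lies between
  its bottom and its top, and never otherwise. Descents that view \<open>v\<close> can therefore be
  counted as runs, and the count depends on the set of runs only, not on their order.
\<close>

definition views :: "nat list set \<Rightarrow> nat \<Rightarrow> nat" where
  "views R v = card {r \<in> R. v < hd r \<and> last r < v \<and> last r < last (run_of R v)}"

text \<open>
  The predicate \<open>Q\<close> selects entire runs and excludes the run of \<open>v\<close>, so in every selected run \<open>v\<close>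
  differs from all entries.
\<close>

lemma length_filter_descents:
  assumes "\<And>r x. r \<in> set (runs xs) \<Longrightarrow> x \<in> set r \<Longrightarrow> Q x \<longleftrightarrow> Q (hd r)" and "\<not> Q v"
  shows "length (filter (\<lambda>(a, b). v < a \<and> b < v \<and> Q a) (zip xs (tl xs))) =
    length (filter (\<lambda>r. v < hd r \<and> last r < v \<and> Q (hd r)) (runs xs))"
  using assms(1)
proof (induction xs rule: runs.induct)
  case (3 x y zs)
  obtain r rs where eq: "runs (y # zs) = (y # r) # rs"
    using runs_Cons by blast
  have "last (y # r) \<le> y"
    using run_decreasing[of "y # r" "y # zs"] sorted_wrt_greater_bounds(1)[of "y # r" y] eq
    by simp
  show ?case
  proof (cases "x > y")
    case True
    have Q: "Q u \<longleftrightarrow> Q x" if "u \<in> set (y # r)" for u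
      using "3.prems"(1)[of "x # y # r" u] that True eq by auto
    have IH: "length (filter (\<lambda>(a, b). v < a \<and> b < v \<and> Q a) (zip (y # zs) (tl (y # zs)))) =
        length (filter (\<lambda>r. v < hd r \<and> last r < v \<and> Q (hd r)) (runs (y # zs)))"
    proof (rule "3.IH"(1)[OF True])
      fix q u assume "q \<in> set (runs (y # zs))" "u \<in> set q"
      then show "Q u \<longleftrightarrow> Q (hd q)"
        using Q "3.prems"(1)[of q u] True eq by (cases "q = y # r") auto
    qed
    \<comment> \<open>Putting \<open>x\<close> in front of the first run adds the descent from \<open>x\<close> to \<open>y\<close> and raises the top
      of that run from \<open>y\<close> to \<open>x\<close>: if \<open>Q\<close> selects the run, both sides grow exactly if \<open>y < v < x\<close>.\<close>
    have "Q x \<Longrightarrow> v \<noteq> x \<and> v \<noteq> y"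
      using Q[of y] assms(2) by auto
    then show ?thesis
      using IH True Q[of y] eq \<open>last (y # r) \<le> y\<close> by auto
  next
    case False
    have "length (filter (\<lambda>(a, b). v < a \<and> b < v \<and> Q a) (zip (y # zs) (tl (y # zs)))) =
        length (filter (\<lambda>r. v < hd r \<and> last r < v \<and> Q (hd r)) (runs (y # zs)))"
      using False "3.prems" by (intro "3.IH"(3)) auto
    then show ?thesis using False by auto
  qed
qed simp_all

lemma count_image_mset_set:
  assumes "finite S"
  shows "count (image_mset h (mset_set S)) v = card {x \<in> S. h x = v}"
proof -
  have "count (image_mset h (mset_set S)) v = (\<Sum>x\<in>h -` {v} \<inter> S. count (mset_set S) x)"
    using assms by (simp add: count_image_mset)
  also have "\<dots> = (\<Sum>x\<in>h -` {v} \<inter> S. 1)"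
    using assms by (intro sum.cong) auto
  also have "\<dots> = card {x \<in> S. h x = v}"
    by (simp, rule arg_cong[where f = card]) auto
  finally show ?thesis .
qed

lemma count_descent_views:
  assumes "p permutes {1..n}" "v \<in> {1..n}"
  shows "count (descent_views n p) v = views (set (runs (one_line n p))) v"
proof -
  let ?xs = "one_line n p"
  let ?R = "set (runs ?xs)"
  let ?Q = "\<lambda>x. last (run_of ?R x) < last (run_of ?R v)"
  have inj: "inj p" using assms(1) by (rule permutes_inj)
  have rs: "run_sequence (runs ?xs)" using assms(1) by (rule runs_one_line(1))
  obtain j where j: "j \<in> {1..n}" "p j = v"
    using assms by (metis permutes_image imageE)
  have "count (descent_views n p) v =
      card {x \<in> {(i, j). i \<in> {1..<n} \<and> j \<in> {1..n} \<and> p i > p j \<and> p j > p (i + 1) \<and>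
          last (run_of ?R (p i)) < last (run_of ?R (p j))}. (\<lambda>(i, j). p j) x = v}"
    unfolding descent_views_def run_containing_def run_of_def
    by (rule count_image_mset_set, rule finite_subset[of _ "{1..n} \<times> {1..n}"]) auto
  \<comment> \<open>The shift \<open>i = Suc k\<close> passes from positions in \<open>{1..n}\<close> to list indices, which start at 0.\<close>
  also have "\<dots> = card {k. Suc k < n \<and> v < p (Suc k) \<and> p (Suc (Suc k)) < v \<and> ?Q (p (Suc k))}"
  proof (rule bij_betw_same_card[symmetric], rule bij_betw_byWitness)
    let ?f = "\<lambda>k. (Suc k, j)" and ?g = "\<lambda>(i::nat, j::nat). i - 1"
    let ?D = "{x \<in> {(i, j). i \<in> {1..<n} \<and> j \<in> {1..n} \<and> p i > p j \<and> p j > p (i + 1) \<and>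
          last (run_of ?R (p i)) < last (run_of ?R (p j))}. (\<lambda>(i, j). p j) x = v}"
    let ?K = "{k. Suc k < n \<and> v < p (Suc k) \<and> p (Suc (Suc k)) < v \<and> ?Q (p (Suc k))}"
    show "\<forall>k\<in>?K. ?g (?f k) = k" by simp
    show "\<forall>x\<in>?D. ?f (?g x) = x"
      using j inj by (auto dest: injD)
    show "?f ` ?K \<subseteq> ?D" using j by auto
    show "?g ` ?D \<subseteq> ?K" by auto
  qed
  also have "\<dots> = length (filter (\<lambda>(a, b). v < a \<and> b < v \<and> ?Q a) (zip ?xs (tl ?xs)))"
    unfolding length_filter_conv_card
    by (intro arg_cong[where f = card]) (auto simp: one_line_def nth_tl simp del: upt_Suc)
  also have "\<dots> = length (filter (\<lambda>r. v < hd r \<and> last r < v \<and> ?Q (hd r)) (runs ?xs))"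
    using run_of_eq[OF rs] run_sequence_mem[OF rs] by (intro length_filter_descents) auto
  also have "\<dots> = card {r \<in> ?R. v < hd r \<and> last r < v \<and> ?Q (hd r)}"
    using run_sequence_distinct[OF rs] by (simp add: distinct_length_filter Int_def conj_commute)
  also have "\<dots> = views ?R v"
    unfolding views_def using run_of_eq[OF rs] run_sequence_mem[OF rs]
    by (intro arg_cong[where f = card]) auto
  finally show ?thesis .
qed

section \<open>Injections with prescribed inversion bottoms\<close>

definition inversions_above :: "(nat \<Rightarrow> nat option) \<Rightarrow> nat \<Rightarrow> nat" where
  "inversions_above f v = card {i \<in> dom f. \<exists>j. f j = Some v \<and> i < j \<and> v < the (f i)}"

lemma count_inversion_bottoms:
  assumes "finite (dom f)" "inj_on f (dom f)"
  shows "count (inversion_bottoms f) v = inversions_above f v"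
proof -
  let ?D = "{x \<in> {(i, j). i \<in> dom f \<and> j \<in> dom f \<and> i < j \<and> the (f i) > the (f j)}.
    (\<lambda>(i, j). the (f j)) x = v}"
  have "count (inversion_bottoms f) v = card ?D"
    unfolding inversion_bottoms_def
    by (rule count_image_mset_set, rule finite_subset[of _ "dom f \<times> dom f"]) (use assms(1) in auto)
  also have "\<dots> = inversions_above f v"
    unfolding inversions_above_def
  proof (rule bij_betw_same_card[of fst], unfold bij_betw_def, intro conjI)
    show "inj_on fst ?D"
      using assms(2) by (auto intro!: inj_onI) (metis domI inj_onD option.sel)
    show "fst ` ?D = {i \<in> dom f. \<exists>j. f j = Some v \<and> i < j \<and> v < the (f i)}"
      by (force simp: image_iff)
  qed
  finally show ?thesis .
qed

lemma inj_on_map_upd: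
  assumes "inj_on f (dom f)" "x \<notin> dom f" "y \<notin> ran f"
  shows "inj_on (f(x \<mapsto> y)) (dom (f(x \<mapsto> y)))"
proof (rule inj_onI)
  let ?g = "f(x \<mapsto> y)"
  fix u v assume uv: "u \<in> dom ?g" "v \<in> dom ?g" "?g u = ?g v"
  have "f z \<noteq> Some y" for z using assms(3) by (auto simp: ran_def)
  then have "u = x \<longleftrightarrow> v = x" using uv(3) by (metis fun_upd_apply)
  then show "u = v" using uv inj_onD[OF assms(1), of u v] by (cases "u = x") auto
qed

text \<open>
  The smallest value \<open>v0\<close> has only larger values around it, so it must go to the position with
  exactly \<open>c v0\<close> positions before it; and since it is smaller than the rest, it leaves the counts of
  the other values unchanged, whatever its position.
\<close>

lemma ex_map_with_inversions:
  assumes "finite A" "finite B" "card A = card B"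
    and "\<And>v. v \<in> B \<Longrightarrow> c v + card {w \<in> B. w < v} < card B"
  shows "\<exists>f. dom f = A \<and> ran f = B \<and> inj_on f (dom f) \<and> (\<forall>v\<in>B. inversions_above f v = c v)"
  using assms
proof (induction "card B" arbitrary: A B)
  case 0
  then show ?case by (auto intro: exI[of _ Map.empty])
next
  case (Suc m)
  define v0 where "v0 = Min B"
  have "B \<noteq> {}" using Suc(2) by auto
  then have v0: "v0 \<in> B" "\<And>w. w \<in> B \<Longrightarrow> v0 \<le> w"
    using Suc(4) by (auto simp: v0_def)
  obtain a where a: "a \<in> A" "card {x \<in> A. x < a} = c v0"
    using ex_element_of_rank[of A "c v0"] Suc(3,5) Suc(6)[OF v0(1)] by force
  have "\<exists>f. dom f = A - {a} \<and> ran f = B - {v0} \<and> inj_on f (dom f) \<and>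
      (\<forall>v\<in>B - {v0}. inversions_above f v = c v)"
  proof (rule Suc(1))
    fix v assume v: "v \<in> B - {v0}"
    then have "{w \<in> B. w < v} = insert v0 {w \<in> B - {v0}. w < v}"
      using v0 by force
    then have "card {w \<in> B. w < v} = Suc (card {w \<in> B - {v0}. w < v})"
      using Suc(4) by simp
    then show "c v + card {w \<in> B - {v0}. w < v} < card (B - {v0})"
      using Suc(6)[of v] v v0(1) Suc(4) by simp
  qed (use Suc(2-5) a(1) v0(1) in auto)
  then obtain f where f: "dom f = A - {a}" "ran f = B - {v0}" "inj_on f (dom f)"
    "\<And>v. v \<in> B - {v0} \<Longrightarrow> inversions_above f v = c v"
    by blast
  let ?g = "f(a \<mapsto> v0)"
  have "f a = None" using f(1) by auto
  have dom: "dom ?g = A" using f(1) a(1) by auto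
  have ran: "ran ?g = B" using f(2) v0(1) \<open>f a = None\<close> by auto
  have "inj_on ?g (dom ?g)"
    using f(1-3) by (intro inj_on_map_upd) auto
  moreover have "inversions_above ?g v = c v" if "v \<in> B" for v
  proof (cases "v = v0")
    case True
    have "v0 < the (f i)" if "i \<in> A" "i \<noteq> a" for i
    proof -
      have "i \<in> dom f" using that f(1) by auto
      then obtain w where "f i = Some w" by auto
      then have "w \<in> B - {v0}" using f(2) by (auto dest: ranI)
      then show ?thesis using v0(2)[of w] \<open>f i = Some w\<close> by auto
    qed
    moreover have "f z \<noteq> Some v0" for z using f(2) by (auto dest: ranI)
    ultimately have "{i \<in> dom ?g. \<exists>j. ?g j = Some v0 \<and> i < j \<and> v0 < the (?g i)} =
        {x \<in> A. x < a}"
      unfolding dom by auto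
    then show ?thesis using True a(2) by (simp add: inversions_above_def)
  next
    case False
    then have "\<not> v < v0" "v \<in> B - {v0}" using v0(2)[of v] that by auto
    have same: "?g j = Some v \<longleftrightarrow> f j = Some v" for j
      using False \<open>f a = None\<close> by auto
    have "i \<in> dom ?g \<and> v < the (?g i) \<longleftrightarrow> i \<in> dom f \<and> v < the (f i)" for i
      using \<open>\<not> v < v0\<close> \<open>f a = None\<close> by (cases "i = a") auto
    then have "{i \<in> dom ?g. \<exists>j. ?g j = Some v \<and> i < j \<and> v < the (?g i)} =
        {i \<in> dom f. \<exists>j. f j = Some v \<and> i < j \<and> v < the (f i)}"
      unfolding same by blast
    then show ?thesis using f(4)[of v] \<open>v \<in> B - {v0}\<close> by (simp add: inversions_above_def)
  qed
  ultimately show ?case using dom ran by blast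
qed

text \<open>
  Once the positions of the values below \<open>v\<close> are known, the remaining positions carry values
  \<open>\<ge> v\<close>, and \<open>v\<close> sits at the one whose rank among them is its number of inversions.
\<close>

lemma map_eqI_inversions:
  assumes "finite (dom f)" "dom f = dom g" "ran f = ran g"
    and "inj_on f (dom f)" "inj_on g (dom g)"
    and "\<And>v. v \<in> ran f \<Longrightarrow> inversions_above f v = inversions_above g v"
  shows "f = g"
proof -
  have eq: "f a = Some v \<longleftrightarrow> g a = Some v" for a v
  proof (induction v arbitrary: a rule: less_induct)
    case (less v)
    show ?case
    proof (cases "v \<in> ran f")
      case True
      define U where "U h = {i \<in> dom h. v \<le> the (h i)}" for h :: "nat \<Rightarrow> nat option"
      have "the (f i) < v \<longleftrightarrow> the (g i) < v" if i: "i \<in> dom f" for i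
      proof -
        obtain w where "f i = Some w"
          using i by auto
        moreover obtain w' where "g i = Some w'"
          using i unfolding assms(2) by auto
        ultimately show ?thesis using less[of w i] less[of w' i] by auto
      qed
      then have U: "U f = U g"
        unfolding U_def assms(2)[symmetric] not_less[symmetric] by blast
      have rank: "x \<in> U h" "card {i \<in> U h. i < x} = inversions_above h v"
        if "h x = Some v" "inj_on h (dom h)" for h x
      proof -
        show "x \<in> U h" using that by (auto simp: U_def)
        have "{i \<in> U h. i < x} = {i \<in> dom h. \<exists>j. h j = Some v \<and> i < j \<and> v < the (h i)}"
          using that by (auto simp: U_def dest: inj_onD) (metis domI inj_onD nat_less_le option.sel)+
        then show "card {i \<in> U h. i < x} = inversions_above h v"
          by (simp add: inversions_above_def)
      qed
      obtain x where x: "f x = Some v" using True by (auto simp: ran_def)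
      obtain y where y: "g y = Some v" using True assms(3) by (auto simp: ran_def)
      have "x = y"
      proof (rule rank_inject)
        show "finite (U f)" using assms(1) by (simp add: U_def)
        show "x \<in> U f" "y \<in> U f"
          using rank(1)[OF x assms(4)] rank(1)[OF y assms(5)] U by auto
        show "card {z \<in> U f. z < x} = card {z \<in> U f. z < y}"
          using rank(2)[OF x assms(4)] rank(2)[OF y assms(5)] U assms(6)[OF True] by simp
      qed
      then show ?thesis
        using x y assms(4,5) by (metis domI inj_onD)
    next
      case False
      then show ?thesis using assms(3) by (metis ranI)
    qed
  qed
  show ?thesis
  proof
    fix a show "f a = g a" using eq[of a] by (metis not_Some_eq)
  qed
qed

text \<open>
  If \<open>v\<close> sat at a position \<open>a \<ge> v\<close>, then each position below \<open>v\<close> would carry either a larger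
  value, forming an inversion with \<open>v\<close>, or one of the smaller values: too few altogether.
\<close>

lemma few_inversions_imp_excedance:
  assumes "finite (dom f)" "inj_on f (dom f)" "f a = Some v"
    and "inversions_above f v + card {w \<in> ran f. w < v} < card {i \<in> dom f. i < v}"
  shows "a < v"
proof (rule ccontr)
  assume "\<not> a < v"
  let ?I = "{i \<in> dom f. \<exists>j. f j = Some v \<and> i < j \<and> v < the (f i)}"
  let ?L = "{i \<in> dom f. the (f i) < v}"
  have "i \<in> ?I \<union> ?L" if i: "i \<in> dom f" "i < v" for i
  proof -
    have "the (f i) \<noteq> v"
      using i assms(2,3) \<open>\<not> a < v\<close> by (metis domI domIff inj_onD option.exhaust_sel)
    then show ?thesis using i assms(3) \<open>\<not> a < v\<close> by (auto simp: neq_iff)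
  qed
  then have "{i \<in> dom f. i < v} \<subseteq> ?I \<union> ?L" by blast
  then have "card {i \<in> dom f. i < v} \<le> card (?I \<union> ?L)"
    using assms(1) by (intro card_mono) auto
  also have "\<dots> \<le> card ?I + card ?L" by (rule card_Un_le)
  also have "card ?L \<le> card {w \<in> ran f. w < v}"
  proof (rule card_inj_on_le)
    show "inj_on (\<lambda>i. the (f i)) ?L"
      using assms(2) by (intro inj_onI) (metis (mono_tags, lifting) domIff inj_onD mem_Collect_eq option.expand)
    show "(\<lambda>i. the (f i)) ` ?L \<subseteq> {w \<in> ran f. w < v}" by (auto intro: ranI)
    show "finite {w \<in> ran f. w < v}" by simp
  qed
  finally show False using assms(4) by (simp add: inversions_above_def)
qed


section \<open>The excedance part\<close>

text \<open>
  The characterisation of \<open>chi_e\<close> in terms of the set \<open>R\<close> of runs alone.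
\<close>

definition excedance_part :: "nat \<Rightarrow> nat list set \<Rightarrow> (nat \<Rightarrow> nat option) \<Rightarrow> bool" where
  "excedance_part n R f \<longleftrightarrow>
     dom f = {1..n} - hd ` R \<and> ran f = {1..n} - last ` R \<and> inj_on f (dom f) \<and>
     (\<forall>v\<in>{1..n} - last ` R. inversions_above f v = views R v)"

lemma card_below_complement:
  assumes "finite R" "inj_on h R" "h ` R \<subseteq> {1..n}" "v \<in> {1..n}"
  shows "card {a \<in> {1..n} - h ` R. a < v} + card {r \<in> R. h r < v} = v - 1"
proof -
  have "card {r \<in> R. h r < v} = card (h ` {r \<in> R. h r < v})"
    using assms(2) by (intro card_image[symmetric]) (auto intro: inj_on_subset)
  moreover have "{1..<v} = {a \<in> {1..n} - h ` R. a < v} \<union> h ` {r \<in> R. h r < v}"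
    using assms(3,4) by auto
  then have "card {1..<v} =
      card {a \<in> {1..n} - h ` R. a < v} + card (h ` {r \<in> R. h r < v})"
    using assms(1) by (simp only:) (intro card_Un_disjoint, auto)
  ultimately show ?thesis by simp
qed

text \<open>
  Below \<open>v\<close> the non-tops outnumber the non-bottoms by the number of runs that have their bottom
  below \<open>v\<close> but not their top. The run of \<open>v\<close> is one of these, and so are the runs counted by
  \<open>views\<close>, from which the run of \<open>v\<close> differs; hence the strict inequality.
\<close>

lemma views_bound:
  assumes rs: "run_sequence rs" "set (concat rs) = {1..n}" and v: "v \<in> {1..n} - last ` set rs"
  shows "views (set rs) v + card {w \<in> {1..n} - last ` set rs. w < v} <
    card {a \<in> {1..n} - hd ` set rs. a < v}"
proof -
  let ?R = "set rs"
  let ?r = "run_of ?R v"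
  have sub: "hd ` ?R \<subseteq> {1..n}" "last ` ?R \<subseteq> {1..n}"
    using run_sequence_ends[OF rs(1)] rs(2) by simp_all
  have r: "?r \<in> ?R" "v \<in> set ?r"
    using run_of_mem[OF rs(1), of v] unfolding rs(2) using v by simp_all
  have "{r \<in> ?R. last r < v} = {r \<in> ?R. hd r < v} \<union> {r \<in> ?R. last r < v \<and> v \<le> hd r}"
    using run_sequence_mem(3)[OF rs(1)] by (force simp: not_le)
  then have "card {r \<in> ?R. last r < v} =
      card {r \<in> ?R. hd r < v} + card {r \<in> ?R. last r < v \<and> v \<le> hd r}"
    by (simp, intro card_Un_disjoint) auto
  moreover have "views ?R v < card {r \<in> ?R. last r < v \<and> v \<le> hd r}"
    unfolding views_def
  proof (rule psubset_card_mono)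
    have "last ?r \<noteq> v" using v imageI[OF r(1), of last] by auto
    then have "?r \<in> {r \<in> ?R. last r < v \<and> v \<le> hd r}"
      using run_sequence_bounds[OF rs(1) r] r(1) by auto
    then show "{r \<in> ?R. v < hd r \<and> last r < v \<and> last r < last ?r} \<subset>
        {r \<in> ?R. last r < v \<and> v \<le> hd r}"
      by auto
  qed simp
  moreover have "card {a \<in> {1..n} - hd ` ?R. a < v} + card {r \<in> ?R. hd r < v} = v - 1"
    using run_sequence_inj[OF rs(1)] sub v by (intro card_below_complement) auto
  moreover have "card {a \<in> {1..n} - last ` ?R. a < v} + card {r \<in> ?R. last r < v} = v - 1"
    using run_sequence_inj[OF rs(1)] sub v by (intro card_below_complement) auto
  ultimately show ?thesis by linarith
qed

lemma ex1_excedance_part: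
  assumes rs: "run_sequence rs" "set (concat rs) = {1..n}"
  shows "\<exists>!f. excedance_part n (set rs) f"
proof (rule ex_ex1I)
  let ?R = "set rs"
  let ?A = "{1..n} - hd ` ?R" and ?B = "{1..n} - last ` ?R"
  have sub: "hd ` ?R \<subseteq> {1..n}" "last ` ?R \<subseteq> {1..n}"
    using run_sequence_ends[OF rs(1)] rs(2) by simp_all
  have "card ?A = card ?B"
    using sub run_sequence_inj[OF rs(1)] by (simp add: card_Diff_subset card_image)
  moreover have "views ?R v + card {w \<in> ?B. w < v} < card ?B" if "v \<in> ?B" for v
  proof -
    have "card {a \<in> ?A. a < v} \<le> card ?A" by (intro card_mono) auto
    then show ?thesis using views_bound[OF rs that] \<open>card ?A = card ?B\<close> by linarith
  qed
  ultimately have "\<exists>f. dom f = ?A \<and> ran f = ?B \<and> inj_on f (dom f) \<and>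
      (\<forall>v\<in>?B. inversions_above f v = views ?R v)"
    by (intro ex_map_with_inversions) auto
  then show "\<exists>f. excedance_part n ?R f"
    by (simp add: excedance_part_def)
next
  fix f g assume "excedance_part n (set rs) f" "excedance_part n (set rs) g"
  then show "f = g"
    by (intro map_eqI_inversions) (auto simp: excedance_part_def)
qed

lemma excedance_part_less:
  assumes "run_sequence rs" "set (concat rs) = {1..n}" "excedance_part n (set rs) f" "f x = Some y"
  shows "x < y"
proof (rule few_inversions_imp_excedance[of f])
  have "y \<in> {1..n} - last ` set rs"
    using assms(3,4) by (auto simp: excedance_part_def dest: ranI)
  then show "inversions_above f y + card {w \<in> ran f. w < y} < card {i \<in> dom f. i < y}"
    using views_bound[OF assms(1,2)] assms(3) by (auto simp: excedance_part_def)
qed (use assms in \<open>auto simp: excedance_part_def\<close>)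

lemma excedance_part_chi_e:
  assumes "p permutes {1..n}"
  shows "excedance_part n (set (runs (one_line n p))) (chi_e n p)"
proof -
  let ?R = "set (runs (one_line n p))"
  note rs = runs_one_line[OF assms]
  have views_outside: "v \<notin># descent_views n p" if "v \<notin> {1..n}" for v
  proof
    assume "v \<in># descent_views n p"
    moreover have "x \<in> S" if "x \<in># mset_set S" for x :: "nat \<times> nat" and S
      using that by (cases "finite S") auto
    ultimately obtain j where "j \<in> {1..n}" "v = p j"
      by (fastforce simp: descent_views_def)
    then show False using that permutes_in_image[OF assms, of j] by blast
  qed
  have "(dom f = {1..n} - hd ` ?R \<and> ran f = {1..n} - last ` ?R \<and> inj_on f (dom f) \<and>
      inversion_bottoms f = filter_mset (\<lambda>v. v \<notin> last ` ?R) (descent_views n p)) \<longleftrightarrow>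
      excedance_part n ?R f" for f
  proof (cases "dom f = {1..n} - hd ` ?R \<and> ran f = {1..n} - last ` ?R \<and> inj_on f (dom f)")
    case True
    then have fin: "finite (dom f)" and inj: "inj_on f (dom f)" by auto
    have outside: "inversions_above f v = 0" if "v \<notin> {1..n} - last ` ?R" for v
    proof -
      have "v \<notin> ran f" using True that by auto
      then have "f j \<noteq> Some v" for j by (auto simp: ran_def)
      then show ?thesis by (simp add: inversions_above_def)
    qed
    have count: "count (filter_mset (\<lambda>v. v \<notin> last ` ?R) (descent_views n p)) v =
        (if v \<in> {1..n} - last ` ?R then views ?R v else 0)" for v
      using count_descent_views[OF assms, of v] views_outside[of v] by (auto simp: not_in_iff)
    have "inversion_bottoms f = filter_mset (\<lambda>v. v \<notin> last ` ?R) (descent_views n p) \<longleftrightarrow>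
        (\<forall>v. inversions_above f v = (if v \<in> {1..n} - last ` ?R then views ?R v else 0))"
      unfolding multiset_eq_iff count count_inversion_bottoms[OF fin inj] ..
    also have "\<dots> \<longleftrightarrow> (\<forall>v\<in>{1..n} - last ` ?R. inversions_above f v = views ?R v)"
      using outside by metis
    finally have "inversion_bottoms f = filter_mset (\<lambda>v. v \<notin> last ` ?R) (descent_views n p) \<longleftrightarrow>
        (\<forall>v\<in>{1..n} - last ` ?R. inversions_above f v = views ?R v)" .
    then show ?thesis using True by (auto simp: excedance_part_def)
  next
    case False
    then show ?thesis by (auto simp: excedance_part_def)
  qed
  then have "chi_e n p = (THE f. excedance_part n ?R f)"
    unfolding chi_e_def run_tops_def run_bottoms_def by simp
  then show ?thesis
    using theI'[OF ex1_excedance_part[OF rs]] by simp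
qed

section \<open>Recovering the runs from the views\<close>

text \<open>
  These are the bottoms of the runs with \<open>last r < v \<le> hd r\<close> (lemma \<open>open_bottoms_eq\<close>). The
  condition \<open>v \<le> hd r\<close> is phrased through the run bottoms assigned to tops \<open>u < v\<close>, which makes
  the set computable once the values below \<open>v\<close> have been distributed to their runs.
\<close>

definition open_bottoms :: "nat list set \<Rightarrow> nat \<Rightarrow> nat set" where
  "open_bottoms R v =
     {b \<in> last ` R. b < v \<and> (\<forall>u\<in>hd ` R. u < v \<longrightarrow> last (run_of R u) \<noteq> b)}"

lemma open_bottoms_eq:
  assumes rs: "run_sequence rs"
  shows "open_bottoms (set rs) v = last ` {r \<in> set rs. last r < v \<and> v \<le> hd r}"
proof -
  have run_hd: "run_of (set rs) (hd r) = r" if "r \<in> set rs" for r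
    using run_of_eq[OF rs that] run_sequence_mem[OF rs that] by simp
  have "(\<forall>q\<in>set rs. hd q < v \<longrightarrow> last q \<noteq> last r) \<longleftrightarrow> v \<le> hd r" if "r \<in> set rs" for r
    using inj_onD[OF run_sequence_inj(2)[OF rs]] that by (metis not_le)
  then show ?thesis
    unfolding open_bottoms_def by (auto simp: run_hd)
qed

lemma rank_in_open_bottoms:
  assumes rs: "run_sequence rs" "set (concat rs) = {1..n}" and v: "v \<in> {1..n} - last ` set rs"
  shows "last (run_of (set rs) v) \<in> open_bottoms (set rs) v"
    and "card {b \<in> open_bottoms (set rs) v. b < last (run_of (set rs) v)} = views (set rs) v"
proof -
  let ?R = "set rs"
  let ?r = "run_of ?R v"
  have r: "?r \<in> ?R" "v \<in> set ?r"
    using run_of_mem[OF rs(1), of v] unfolding rs(2) using v by simp_all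
  have "last ?r \<noteq> v" using v imageI[OF r(1), of last] by auto
  then show "last ?r \<in> open_bottoms ?R v"
    using run_sequence_bounds[OF rs(1) r] r(1) by (auto simp: open_bottoms_eq[OF rs(1)])
  have "v \<noteq> hd q" if "q \<in> ?R" "last q < last ?r" for q
    using run_of_eq[OF rs(1), of q v] run_sequence_mem[OF rs(1), of q] that by auto
  then have "{b \<in> open_bottoms ?R v. b < last ?r} =
      last ` {q \<in> ?R. v < hd q \<and> last q < v \<and> last q < last ?r}"
    unfolding open_bottoms_eq[OF rs(1)] by (auto simp: le_less)
  then show "card {b \<in> open_bottoms ?R v. b < last ?r} = views ?R v"
    unfolding views_def using run_sequence_inj(2)[OF rs(1)]
    by (simp add: card_image inj_on_subset)
qed

text \<open>
  By induction on \<open>v\<close> the bottom of the run of \<open>v\<close> is determined: it is \<open>v\<close> itself or the open bottom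
  whose rank is the number of views of \<open>v\<close>. A run is the decreasing arrangement of the values
  that share its bottom.
\<close>

lemma views_determine_runs:
  assumes rs: "run_sequence rs" "set (concat rs) = {1..n}"
    and rs': "run_sequence rs'" "set (concat rs') = {1..n}"
    and tops: "hd ` set rs = hd ` set rs'" and bots: "last ` set rs = last ` set rs'"
    and views: "\<And>v. v \<in> {1..n} - last ` set rs \<Longrightarrow> views (set rs) v = views (set rs') v"
  shows "set rs = set rs'"
proof -
  have bot: "last (run_of (set rs) v) = last (run_of (set rs') v)" if "v \<in> {1..n}" for v
    using that
  proof (induction v rule: less_induct)
    case (less v)
    show ?case
    proof (cases "v \<in> last ` set rs")
      case True
      have self: "last (run_of (set qs) v) = v" if "run_sequence qs" "v \<in> last ` set qs" for qs
        using that run_of_eq[OF that(1)] run_sequence_mem[OF that(1)] by auto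
      show ?thesis using self[OF rs(1)] self[OF rs'(1)] True bots by simp
    next
      case False
      have "hd ` set rs \<subseteq> {1..n}"
        using run_sequence_ends(1)[OF rs(1)] rs(2) by simp
      then have "last (run_of (set rs) u) = last (run_of (set rs') u)"
        if "u \<in> hd ` set rs'" "u < v" for u
        using less.IH that tops by auto
      then have open_eq: "open_bottoms (set rs) v = open_bottoms (set rs') v"
        unfolding open_bottoms_def tops bots by auto
      have v: "v \<in> {1..n} - last ` set rs" "v \<in> {1..n} - last ` set rs'"
        using False less.prems bots by auto
      show ?thesis
      proof (rule rank_inject)
        show "finite (open_bottoms (set rs) v)"
          by (simp add: open_bottoms_def)
      qed (use rank_in_open_bottoms[OF rs v(1)] rank_in_open_bottoms[OF rs' v(2)] open_eq
            views[OF v(1)] in auto)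
    qed
  qed
  have set_run: "set r = {v \<in> {1..n}. last (run_of (set qs) v) = last r}"
    if "run_sequence qs" "set (concat qs) = {1..n}" "r \<in> set qs" for qs r
  proof (intro set_eqI iffI)
    fix v assume "v \<in> set r"
    moreover from this have "v \<in> {1..n}"
      unfolding that(2)[symmetric] using that(3) by auto
    ultimately show "v \<in> {v \<in> {1..n}. last (run_of (set qs) v) = last r}"
      using run_of_eq[OF that(1,3)] by simp
  next
    fix v assume v: "v \<in> {v \<in> {1..n}. last (run_of (set qs) v) = last r}"
    then have "v \<in> set (concat qs)" using that(2) by simp
    then have "run_of (set qs) v \<in> set qs" "v \<in> set (run_of (set qs) v)"
      using run_of_mem[OF that(1)] by auto
    moreover from this(1) have "run_of (set qs) v = r"
      using inj_onD[OF run_sequence_inj(2)[OF that(1)]] that(3) v by auto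
    ultimately show "v \<in> set r" by simp
  qed
  have sub: "set qs \<subseteq> set qs'"
    if qs: "run_sequence qs" "set (concat qs) = {1..n}"
      and qs': "run_sequence qs'" "set (concat qs') = {1..n}"
      and bots': "last ` set qs = last ` set qs'"
      and bot': "\<And>v. v \<in> {1..n} \<Longrightarrow> last (run_of (set qs) v) = last (run_of (set qs') v)"
    for qs qs'
  proof
    fix r assume r: "r \<in> set qs"
    then obtain q where q: "q \<in> set qs'" "last q = last r"
      using bots' by (metis imageE imageI)
    have "set r = set q"
      using set_run[OF qs r] set_run[OF qs' q(1)] q(2) bot' by auto
    moreover have "sorted_wrt (<) (rev r)" "sorted_wrt (<) (rev q)"
      using qs(1) qs'(1) r q(1) by (auto simp: run_sequence_def sorted_wrt_rev)
    ultimately have "rev r = rev q"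
      by (intro strict_sorted_equal) auto
    then show "r \<in> set qs'" using q(1) by simp
  qed
  show ?thesis
    using sub[OF rs rs' bots] sub[OF rs' rs bots[symmetric]] bot by force
qed

section \<open>Iterated preimages\<close>

lemma partial_pow_0: "partial_pow f 0 s = Some s"
  by (simp add: partial_pow_def)

lemma partial_pow_Suc: "partial_pow f (Suc k) s = Option.bind (partial_pow f k s) f"
  by (simp add: partial_pow_def)

lemma partial_pow_add:
  "partial_pow f (k + l) s = Option.bind (partial_pow f k s) (partial_pow f l)"
proof (induction l)
  case 0
  then show ?case by (cases "partial_pow f k s") (simp_all add: partial_pow_0)
next
  case (Suc l)
  then show ?case by (cases "partial_pow f k s") (simp_all add: partial_pow_Suc)
qed

lemma partial_pow_prefix:
  assumes "partial_pow f k s = Some t" "m < k"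
  shows "\<exists>x\<in>dom f. partial_pow f m s = Some x"
proof -
  have "partial_pow f (Suc m + (k - Suc m)) s = Some t"
    using assms by simp
  then show ?thesis
    unfolding partial_pow_add partial_pow_Suc
    by (cases "partial_pow f m s") (auto simp: bind_eq_Some_conv)
qed

text \<open>
  A path that revisited a point would be periodic from there on and could never leave the domain;
  so a path ending outside the domain visits distinct points. This makes the maximal exponent
  in the definition of the iterated preimage exist.
\<close>

lemma partial_pow_bound:
  assumes "finite (dom f)" "t \<notin> dom f" "partial_pow f k s = Some t"
  shows "k \<le> card (dom f)"
proof -
  let ?x = "\<lambda>m. the (partial_pow f m s)"
  have neq: "partial_pow f i s \<noteq> partial_pow f j s" if "i < j" "j < k" for i j
  proof
    assume "partial_pow f i s = partial_pow f j s"
    then have "partial_pow f (i + (k - j)) s = partial_pow f (j + (k - j)) s"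
      by (simp add: partial_pow_add)
    then have "partial_pow f (i + (k - j)) s = Some t"
      using that assms(3) by simp
    moreover have "i + (k - j) < k" using that by simp
    ultimately show False using partial_pow_prefix[OF assms(3)] assms(2) by force
  qed
  have "inj_on ?x {..<k}"
  proof (rule inj_onI)
    fix i j assume ij: "i \<in> {..<k}" "j \<in> {..<k}" "?x i = ?x j"
    then have "partial_pow f i s = partial_pow f j s"
      using partial_pow_prefix[OF assms(3), of i] partial_pow_prefix[OF assms(3), of j] by auto
    then show "i = j" using neq[of i j] neq[of j i] ij by (cases i j rule: linorder_cases) auto
  qed
  moreover have "?x ` {..<k} \<subseteq> dom f"
    using partial_pow_prefix[OF assms(3)] by force
  ultimately show ?thesis
    using card_inj_on_le[OF _ _ assms(1)] by fastforce
qed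

lemma partial_pow_inj:
  assumes "inj_on f (dom f)" "partial_pow f k s = Some t" "partial_pow f k s' = Some t"
  shows "s = s'"
  using assms(2,3)
proof (induction k arbitrary: t)
  case (Suc k)
  then show ?case
    using assms(1) by (auto simp: partial_pow_Suc bind_eq_Some_conv) (metis domI inj_onD)
qed (simp add: partial_pow_0)

lemma iterated_preimage:
  assumes "finite (dom f)" "inj_on f (dom f)" "t \<notin> dom f"
  shows "iterated_preimage f t \<notin> ran f" "\<exists>k. partial_pow f k (iterated_preimage f t) = Some t"
proof -
  let ?K = "{k. \<exists>s. partial_pow f k s = Some t}"
  let ?P = "\<lambda>s. \<exists>k. partial_pow f k s = Some t \<and>
     (\<forall>k' s'. partial_pow f k' s' = Some t \<longrightarrow> k' \<le> k)"
  have fin: "finite ?K"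
  proof (rule finite_subset)
    show "?K \<subseteq> {..card (dom f)}"
      using partial_pow_bound[OF assms(1,3)] by blast
  qed simp
  moreover have "?K \<noteq> {}" using partial_pow_0 by fast
  ultimately have "Max ?K \<in> ?K" by (rule Max_in)
  then obtain s where "partial_pow f (Max ?K) s = Some t" by blast
  then have "?P s" using Max_ge[OF fin] by blast
  moreover have "s' = s''" if s': "?P s'" and s'': "?P s''" for s' s''
  proof -
    obtain k' where k': "partial_pow f k' s' = Some t"
      "\<And>k s. partial_pow f k s = Some t \<Longrightarrow> k \<le> k'"
      using s' by blast
    obtain k'' where k'': "partial_pow f k'' s'' = Some t"
      "\<And>k s. partial_pow f k s = Some t \<Longrightarrow> k \<le> k''"
      using s'' by blast
    have "k' = k''" using k'(2)[OF k''(1)] k''(2)[OF k'(1)] by simp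
    then show ?thesis using partial_pow_inj[OF assms(2) k'(1)] k''(1) by simp
  qed
  ultimately have "\<exists>!s. ?P s" by (intro ex_ex1I exI[of ?P s])
  then have P: "?P (iterated_preimage f t)"
    unfolding iterated_preimage_def by (rule theI')
  then show "\<exists>k. partial_pow f k (iterated_preimage f t) = Some t" by blast
  show "iterated_preimage f t \<notin> ran f"
  proof
    assume "iterated_preimage f t \<in> ran f"
    then obtain u where "f u = Some (iterated_preimage f t)" by (auto simp: ran_def)
    then have "partial_pow f (1 + k) u = partial_pow f k (iterated_preimage f t)" for k
      unfolding partial_pow_add by (simp add: partial_pow_Suc partial_pow_0)
    then show False using P by (metis Suc_n_not_le_n plus_1_eq_Suc)
  qed
qed

text \<open>
  The hypothesis says that no step of the path leads from above \<open>t\<close> to a point \<open>\<le> t\<close>.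
\<close>

lemma partial_pow_start_le:
  assumes "\<And>x y. f x = Some y \<Longrightarrow> y \<le> t \<Longrightarrow> x \<le> t"
    and "partial_pow f k s = Some u" "u \<le> (t::nat)"
  shows "s \<le> t"
  using assms(2,3)
proof (induction k arbitrary: u)
  case (Suc k)
  then show ?case using assms(1) by (auto simp: partial_pow_Suc bind_eq_Some_conv)
qed (simp add: partial_pow_0)


section \<open>One step of the procedure\<close>

text \<open>
  The invariant of the procedure. The second to last clause holds because only tops of runs
  removed earlier have images that do not exceed them. The last clause compares the values not yet attained with the bottoms of the remaining runs: they are
  equally many up to every bound \<open>x\<close> that reaches some remaining top. For smaller \<open>x\<close> this may
  fail, as a step can remove a different value from the one set than from the other.
\<close>

definition procedure_state :: "nat \<Rightarrow> nat list list \<Rightarrow> (nat \<Rightarrow> nat option) \<Rightarrow> bool" where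
  "procedure_state n rs f \<longleftrightarrow>
     run_sequence rs \<and> set (concat rs) \<subseteq> {1..n} \<and>
     dom f = {1..n} - hd ` set rs \<and> ran f \<subseteq> {1..n} \<and> inj_on f (dom f) \<and>
     (\<forall>x y. \<forall>r\<in>set rs. f x = Some y \<longrightarrow> y \<le> x \<longrightarrow> x < hd r) \<and>
     (\<forall>x. \<forall>r\<in>set rs. hd r \<le> x \<longrightarrow>
        card {y \<in> {1..n} - ran f. y \<le> x} = card {q \<in> set rs. last q \<le> x})"

text \<open>
  One step of the procedure: \<open>r\<close> is the run with the smallest top, \<open>l\<close> and \<open>rr\<close> are the runs to its
  left and right.
\<close>

locale min_top_removal =
  fixes n :: nat and l :: "nat list list" and r :: "nat list" and rr :: "nat list list"
    and f :: "nat \<Rightarrow> nat option"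
  assumes state: "procedure_state n (l @ r # rr) f"
    and min_top: "\<And>q. q \<in> set (l @ rr) \<Longrightarrow> hd r < hd q"
begin

abbreviation free :: "nat set" where
  "free \<equiv> {1..n} - ran f"

abbreviation start :: nat where
  "start \<equiv> iterated_preimage f (hd r)"

abbreviation position :: nat where
  "position \<equiv> card {b \<in> last ` set (l @ rr). b \<le> last (last l)}"

definition new_image :: nat where
  "new_image =
     (if l = [] then start else sorted_list_of_set (free - {start}) ! (position - 1))"

lemma run_sequence_state: "run_sequence (l @ r # rr)"
  using state by (simp add: procedure_state_def)

text \<open>
  If \<open>q\<close> and \<open>q'\<close> are the neighbours of \<open>r\<close>, then \<open>last q < hd r < hd q'\<close>.
\<close>

lemma run_sequence_rest: "run_sequence (l @ rr)"
  using run_sequence_state by (cases l rule: rev_cases; cases rr)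
    (fastforce simp: run_sequence_def successively_append_iff successively_Cons min_top
      dest: min_top intro: less_trans)+

lemma f_props:
  shows "dom f = {1..n} - hd ` set (l @ r # rr)" "ran f \<subseteq> {1..n}" "inj_on f (dom f)"
    and "\<And>x y q. f x = Some y \<Longrightarrow> y \<le> x \<Longrightarrow> q \<in> set (l @ r # rr) \<Longrightarrow> x < hd q"
    and "\<And>x q. q \<in> set (l @ r # rr) \<Longrightarrow> hd q \<le> x \<Longrightarrow>
      card {y \<in> free. y \<le> x} = card {q \<in> set (l @ r # rr). last q \<le> x}"
  using state unfolding procedure_state_def by blast+

lemma top_bounds: "hd r \<in> {1..n}" "hd r \<notin> dom f" "last r \<le> hd r"
  using run_sequence_mem[OF run_sequence_state, of r] state f_props(1) by (auto simp: procedure_state_def)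

text \<open>
  The path ending at the smallest remaining top \<open>hd r\<close> stays below it: an argument is less than its
  image or less than every remaining top.
\<close>

lemma start: "start \<in> free" "start \<le> hd r"
proof -
  have "finite (dom f)" using f_props(1) by simp
  note pre = iterated_preimage[OF this f_props(3) top_bounds(2)]
  obtain k where k: "partial_pow f k start = Some (hd r)" using pre(2) by blast
  have "start = hd r \<or> start \<in> dom f"
    using k partial_pow_prefix[OF k, of 0] by (cases k) (auto simp: partial_pow_0)
  then show "start \<in> free" using pre(1) top_bounds(1) f_props(1) by auto
  show "start \<le> hd r"
  proof (rule partial_pow_start_le[OF _ k])
    fix x y assume "f x = Some y" "y \<le> hd r"
    then show "x \<le> hd r" using f_props(4)[of x y r] by (cases "y \<le> x") auto
  qed simp
qed

lemma card_runs_le: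
  assumes "hd r \<le> x"
  shows "card {q \<in> set (l @ r # rr). last q \<le> x} = Suc (card {q \<in> set (l @ rr). last q \<le> x})"
proof -
  have "r \<notin> set (l @ rr)" using min_top by blast
  moreover have "{q \<in> set (l @ r # rr). last q \<le> x} = insert r {q \<in> set (l @ rr). last q \<le> x}"
    using top_bounds(3) assms by auto
  ultimately show ?thesis by simp
qed

text \<open>
  The bottom left of \<open>hd r\<close> is less than \<open>hd r\<close>, so its index is at most the number of remaining
  bottoms up to \<open>hd r\<close>. By the invariant this is the number of free values up to \<open>hd r\<close> other
  than \<open>start\<close>: removing \<open>r\<close> loses one bottom, removing \<open>start\<close> loses one value.
\<close>

lemma position:
  assumes "l \<noteq> []"
  shows "0 < position" "position - 1 < card {y \<in> free - {start}. y \<le> hd r}"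
proof -
  have b: "last (last l) \<in> last ` set (l @ rr)"
    using assms by simp
  then show "0 < position"
    by (subst card_gt_0_iff) auto
  have lt: "last (last l) < hd r"
    using run_sequence_state assms by (simp add: run_sequence_def successively_append_iff)
  have "position \<le> card (last ` {q \<in> set (l @ rr). last q \<le> hd r})"
    using lt by (intro card_mono) auto
  also have "\<dots> \<le> card {q \<in> set (l @ rr). last q \<le> hd r}"
    by (intro card_image_le) simp
  also have "\<dots> = card {y \<in> free. y \<le> hd r} - 1"
    using f_props(5)[of r "hd r"] card_runs_le[of "hd r"] by simp
  also have "\<dots> = card ({y \<in> free. y \<le> hd r} - {start})"
    using start by simp
  also have "{y \<in> free. y \<le> hd r} - {start} = {y \<in> free - {start}. y \<le> hd r}"
    by auto
  finally show "position - 1 < card {y \<in> free - {start}. y \<le> hd r}"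
    using \<open>0 < position\<close> by linarith
qed

lemma position_in_range:
  assumes "l \<noteq> []"
  shows "position - 1 < length (sorted_list_of_set (free - {start}))"
proof -
  have "card {y \<in> free - {start}. y \<le> hd r} \<le> card (free - {start})"
    by (intro card_mono) auto
  then show ?thesis using position(2)[OF assms] by simp
qed

text \<open>
  The value \<open>start\<close> is excluded from the candidates when \<open>l\<close> is nonempty; this is how the result
  shows whether the removed run was the first one.
\<close>

lemma new_image: "new_image \<in> free" "new_image \<le> hd r" "new_image = start \<longleftrightarrow> l = []"
proof -
  have "new_image \<in> free - {start} \<and> new_image \<le> hd r" if "l \<noteq> []"
  proof
    have eq: "new_image = sorted_list_of_set (free - {start}) ! (position - 1)"
      using that by (simp add: new_image_def)
    show "new_image \<in> free - {start}"
      using nth_mem[OF position_in_range[OF that]] unfolding eq[symmetric] by simp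
    show "new_image \<le> hd r"
      unfolding eq by (rule nth_sorted_list_of_set_le[OF _ position(2)[OF that]]) simp
  qed
  then show "new_image \<in> free" "new_image \<le> hd r" "new_image = start \<longleftrightarrow> l = []"
    using start by (auto simp: new_image_def)
qed

lemma chi_procedure_step:
  "chi_procedure n (l @ r # rr) f = chi_procedure n (l @ rr) (f(hd r \<mapsto> new_image))"
proof -
  have ne: "hd q \<noteq> hd r" if "q \<in> set l \<or> q \<in> set rr" for q
    using min_top[of q] that by auto
  have "Min (hd ` set (l @ r # rr)) = hd r"
    using min_top by (intro Min_eqI) (auto intro: less_imp_le)
  moreover have "filter (\<lambda>q. hd q \<noteq> hd r) l = l" "filter (\<lambda>q. hd q \<noteq> hd r) rr = rr"
    by (auto simp: ne filter_id_conv)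
  moreover have "takeWhile (\<lambda>q. hd q \<noteq> hd r) (l @ r # rr) = l"
    by (simp add: ne takeWhile_append2)
  moreover have "A - {start} - ran f = A - ran f - {start}" for A
    by auto
  ultimately show ?thesis
    by (subst chi_procedure.simps) (simp add: Let_def new_image_def)
qed

text \<open>
  The step uses up a value \<open>\<le> hd r\<close> and a bottom \<open>\<le> hd r\<close>. The bounds \<open>x\<close> in the invariant now exceed
  \<open>hd r\<close>, so both counts drop by one.
\<close>

lemma state_step: "procedure_state n (l @ rr) (f(hd r \<mapsto> new_image))"
proof -
  let ?g = "f(hd r \<mapsto> new_image)"
  have "f (hd r) = None" using top_bounds(2) by auto
  then have ran: "ran ?g = insert new_image (ran f)" by auto
  have "new_image \<notin> ran f" using new_image(1) by auto
  then have "inj_on ?g (dom ?g)"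
    using f_props(3) top_bounds(2) by (intro inj_on_map_upd)
  moreover have "hd r \<notin> hd ` set (l @ rr)"
    using min_top by force
  then have "dom ?g = {1..n} - hd ` set (l @ rr)"
    using f_props(1) top_bounds(1) by auto
  moreover have "card {y \<in> {1..n} - ran ?g. y \<le> x} = card {q \<in> set (l @ rr). last q \<le> x}"
    if q: "q \<in> set (l @ rr)" "hd q \<le> x" for q x
  proof -
    have "hd r \<le> x" using min_top[OF q(1)] q(2) by simp
    then have "card {y \<in> free. y \<le> x} = Suc (card {q \<in> set (l @ rr). last q \<le> x})"
      using f_props(5)[of r x] card_runs_le by simp
    moreover have "{y \<in> {1..n} - ran ?g. y \<le> x} = {y \<in> free. y \<le> x} - {new_image}"
      unfolding ran by auto
    ultimately show ?thesis
      using new_image(1,2) \<open>hd r \<le> x\<close> by simp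
  qed
  moreover have "x < hd q" if "?g x = Some y" "y \<le> x" "q \<in> set (l @ rr)" for x y q
    using that f_props(4)[of x y q] min_top by (auto split: if_splits)
  moreover have "set (concat (l @ rr)) \<subseteq> {1..n}"
    using state by (auto simp: procedure_state_def)
  moreover have "ran ?g \<subseteq> {1..n}"
    using f_props(2) new_image(1) unfolding ran by auto
  ultimately show ?thesis
    unfolding procedure_state_def using run_sequence_rest by blast
qed

end

lemma ex_min_top_removal:
  assumes "procedure_state n rs f" "rs \<noteq> []"
  obtains l r rr where "rs = l @ r # rr" "min_top_removal n l r rr f"
proof -
  have "Min (hd ` set rs) \<in> hd ` set rs" using assms(2) by (intro Min_in) auto
  then obtain r where r: "r \<in> set rs" "hd r = Min (hd ` set rs)" by auto
  then obtain l rr where eq: "rs = l @ r # rr" by (meson split_list)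
  have run: "run_sequence rs" using assms(1) by (simp add: procedure_state_def)
  have "hd r < hd q" if "q \<in> set (l @ rr)" for q
  proof -
    have "q \<in> set rs" "q \<noteq> r" using that eq run_sequence_distinct[OF run] by auto
    then have "hd q \<noteq> hd r" using inj_onD[OF run_sequence_inj(1)[OF run]] r(1) by blast
    moreover have "hd r \<le> hd q" using r(2) \<open>q \<in> set rs\<close> by simp
    ultimately show ?thesis by simp
  qed
  then show thesis
    using that eq assms(1) by (simp add: min_top_removal_def)
qed

section \<open>The result of the procedure\<close>

lemma chi_procedure_Nil: "chi_procedure n [] f = f"
  by (subst chi_procedure.simps) simp

lemma chi_procedure_result:
  assumes "procedure_state n rs f"
  shows "dom (chi_procedure n rs f) = {1..n}" "ran (chi_procedure n rs f) \<subseteq> {1..n}"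
    and "inj_on (chi_procedure n rs f) {1..n}" "f \<subseteq>\<^sub>m chi_procedure n rs f"
    and "\<And>r. r \<in> set rs \<Longrightarrow> the (chi_procedure n rs f (hd r)) \<le> hd r"
proof -
  have "dom (chi_procedure n rs f) = {1..n} \<and> ran (chi_procedure n rs f) \<subseteq> {1..n} \<and>
    inj_on (chi_procedure n rs f) {1..n} \<and> f \<subseteq>\<^sub>m chi_procedure n rs f \<and>
    (\<forall>r\<in>set rs. the (chi_procedure n rs f (hd r)) \<le> hd r)"
    using assms
  proof (induction rs arbitrary: f rule: length_induct)
    case (1 rs)
    show ?case
    proof (cases "rs = []")
      case True
      then show ?thesis using 1(2) by (auto simp: procedure_state_def chi_procedure_Nil)
    next
      case False
      obtain l r rr where rs: "rs = l @ r # rr" and step: "min_top_removal n l r rr f"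
        using ex_min_top_removal[OF 1(2) False] .
      interpret min_top_removal n l r rr f by (rule step)
      let ?g = "f(hd r \<mapsto> new_image)" and ?h = "chi_procedure n rs f"
      have IH: "dom ?h = {1..n}" "ran ?h \<subseteq> {1..n}" "inj_on ?h {1..n}" "?g \<subseteq>\<^sub>m ?h"
        "\<And>q. q \<in> set (l @ rr) \<Longrightarrow> the (?h (hd q)) \<le> hd q"
        using 1(1)[rule_format, OF _ state_step] chi_procedure_step unfolding rs by simp_all
      have "?h (hd r) = Some new_image"
        using IH(4) by (auto simp: map_le_def)
      moreover have "f \<subseteq>\<^sub>m ?g"
        using top_bounds(2) by (auto simp: map_le_def)
      ultimately show ?thesis
        using IH new_image(2) map_le_trans unfolding rs by auto
    qed
  qed
  then show "dom (chi_procedure n rs f) = {1..n}" "ran (chi_procedure n rs f) \<subseteq> {1..n}"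
    "inj_on (chi_procedure n rs f) {1..n}" "f \<subseteq>\<^sub>m chi_procedure n rs f"
    "\<And>r. r \<in> set rs \<Longrightarrow> the (chi_procedure n rs f (hd r)) \<le> hd r"
    by blast+
qed

lemma append_eq_same_last:
  assumes "l @ rr = l' @ rr'" "distinct (l @ rr)" "l \<noteq> []" "l' \<noteq> []" "last l = last l'"
  shows "l = l' \<and> rr = rr'"
proof -
  obtain k k' x where l: "l = k @ [x]" and l': "l' = k' @ [x]"
    using assms(3-5) by (metis append_butlast_last_id)
  have "x \<notin> set k" "x \<notin> set rr" using assms(2) by (auto simp: l)
  moreover have "k @ x # rr = k' @ x # rr'" using assms(1) by (simp add: l l')
  ultimately show ?thesis
    by (simp add: append_Cons_eq_iff l l')
qed

text \<open>
  The run removed first depends only on the set of runs. Its top keeps its image until the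
  end, so the common result shows where that run was inserted into the others, whose order
  is known by induction.
\<close>

lemma chi_procedure_inject:
  assumes "procedure_state n rs f" "procedure_state n rs' f" "set rs = set rs'"
    and "chi_procedure n rs f = chi_procedure n rs' f"
  shows "rs = rs'"
  using assms
proof (induction rs arbitrary: rs' f rule: length_induct)
  case (1 rs)
  show ?case
  proof (cases "rs = []")
    case True
    then show ?thesis using 1(4) by simp
  next
    case False
    then have "rs' \<noteq> []" using 1(4) by auto
    obtain l r rr where rs: "rs = l @ r # rr" and step: "min_top_removal n l r rr f"
      using ex_min_top_removal[OF 1(2) False] .
    obtain l' r' rr' where rs': "rs' = l' @ r' # rr'" and step': "min_top_removal n l' r' rr' f"
      using ex_min_top_removal[OF 1(3) \<open>rs' \<noteq> []\<close>] .
    have r: "r' = r"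
    proof (rule ccontr)
      assume "r' \<noteq> r"
      then have "r' \<in> set (l @ rr)" "r \<in> set (l' @ rr')"
        using 1(4) unfolding rs rs' by auto
      then show False
        using min_top_removal.min_top[OF step] min_top_removal.min_top[OF step']
        by (meson less_asym)
    qed
    interpret A: min_top_removal n l r rr f by (rule step)
    interpret B: min_top_removal n l' r rr' f using step' unfolding r .
    have "r \<notin> set (l @ rr)" "r \<notin> set (l' @ rr')"
      using A.min_top B.min_top by blast+
    then have rest: "set (l @ rr) = set (l' @ rr')"
      using 1(4) unfolding rs rs' r by auto
    let ?g = "f(hd r \<mapsto> A.new_image)" and ?g' = "f(hd r \<mapsto> B.new_image)"
    have "?g \<subseteq>\<^sub>m chi_procedure n rs f"
      using chi_procedure_result(4)[OF A.state_step] A.chi_procedure_step rs by simp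
    moreover have "?g' \<subseteq>\<^sub>m chi_procedure n rs f"
      using chi_procedure_result(4)[OF B.state_step] B.chi_procedure_step rs' 1(5) r by simp
    ultimately have "?g (hd r) = ?g' (hd r)"
      unfolding map_le_def by (metis domI fun_upd_same)
    then have image: "A.new_image = B.new_image" by simp
    have IH: "l @ rr = l' @ rr'"
    proof (rule 1(1)[rule_format])
      show "procedure_state n (l' @ rr') ?g"
        using B.state_step unfolding image .
      show "chi_procedure n (l @ rr) ?g = chi_procedure n (l' @ rr') ?g"
        using 1(5) A.chi_procedure_step B.chi_procedure_step unfolding rs rs' r image by simp
    qed (use rs A.state_step rest in simp_all)
    show ?thesis
    proof (cases "l = []")
      case True
      then have "l' = []" using A.new_image(3) B.new_image(3) image r by simp
      then show ?thesis using True IH r rs rs' by simp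
    next
      case False
      then have "l' \<noteq> []" using A.new_image(3) B.new_image(3) image r by simp
      let ?L = "sorted_list_of_set (A.free - {A.start})"
      have "?L ! (A.position - 1) = ?L ! (B.position - 1)"
        using image False \<open>l' \<noteq> []\<close> r unfolding A.new_image_def B.new_image_def by simp
      then have "A.position - 1 = B.position - 1"
        using A.position_in_range[OF False] B.position_in_range[OF \<open>l' \<noteq> []\<close>] r
        by (subst (asm) nth_eq_iff_index_eq) auto
      then have "A.position = B.position"
        using A.position(1)[OF False] B.position(1)[OF \<open>l' \<noteq> []\<close>] by linarith
      have mem: "last l \<in> set (l @ rr)" "last l' \<in> set (l @ rr)"
      proof -
        show "last l \<in> set (l @ rr)" using False by simp
        show "last l' \<in> set (l @ rr)" unfolding rest using \<open>l' \<noteq> []\<close> by simp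
      qed
      have "last (last l) = last (last l')"
      proof (rule rank_le_inject)
        show "card {b \<in> last ` set (l @ rr). b \<le> last (last l)} =
            card {b \<in> last ` set (l @ rr). b \<le> last (last l')}"
          using \<open>A.position = B.position\<close> unfolding rest .
      qed (use mem in auto)
      then have "last l = last l'"
        using inj_onD[OF run_sequence_inj(2)[OF A.run_sequence_rest]] mem by blast
      then have "l = l' \<and> rr = rr'"
        using append_eq_same_last[OF IH run_sequence_distinct[OF A.run_sequence_rest] False \<open>l' \<noteq> []\<close>]
        by simp
      then show ?thesis using rs rs' r by simp
    qed
  qed
qed

section \<open>Reading the permutation off its image\<close>

text \<open>
  At the start the values not attained are precisely the run bottoms.
\<close>

lemma initial_state:
  assumes "p permutes {1..n}"
  shows "procedure_state n (runs (one_line n p)) (chi_e n p)"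
proof -
  let ?rs = "runs (one_line n p)" and ?f = "chi_e n p"
  note rs = runs_one_line[OF assms]
  note f = excedance_part_chi_e[OF assms]
  have "x < y" if "?f x = Some y" for x y
    using excedance_part_less[OF rs f that] .
  moreover have "card {y \<in> {1..n} - ran ?f. y \<le> x} = card {q \<in> set ?rs. last q \<le> x}" for x
  proof -
    have "{1..n} - ran ?f = last ` set ?rs"
      using f run_sequence_ends(2)[OF rs(1)] rs(2) by (auto simp: excedance_part_def)
    then have "{y \<in> {1..n} - ran ?f. y \<le> x} = last ` {q \<in> set ?rs. last q \<le> x}"
      by auto
    then show ?thesis
      using run_sequence_inj(2)[OF rs(1)] by (simp add: card_image inj_on_subset)
  qed
  ultimately show ?thesis
    unfolding procedure_state_def using rs f
    by (auto simp: excedance_part_def dest: leD)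
qed

lemma chi_eq_procedure:
  assumes "p permutes {1..n}" "x \<in> {1..n}"
  shows "chi_procedure n (runs (one_line n p)) (chi_e n p) x = Some (chi n p x)"
proof -
  have "x \<in> dom (chi_procedure n (runs (one_line n p)) (chi_e n p))"
    using chi_procedure_result(1)[OF initial_state[OF assms(1)]] assms(2) by simp
  then show ?thesis by (auto simp: chi_def)
qed

lemma chi_outside:
  assumes "p permutes {1..n}" "x \<notin> {1..n}"
  shows "chi_procedure n (runs (one_line n p)) (chi_e n p) x = None" "chi n p x = x"
proof -
  have "x \<notin> dom (chi_procedure n (runs (one_line n p)) (chi_e n p))"
    using chi_procedure_result(1)[OF initial_state[OF assms(1)]] assms(2) by simp
  then show "chi_procedure n (runs (one_line n p)) (chi_e n p) x = None" "chi n p x = x"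
    by (auto simp: chi_def domIff)
qed

lemma chi_permutes:
  assumes p: "p permutes {1..n}"
  shows "chi n p permutes {1..n}"
proof (rule bij_imp_permutes)
  note result = chi_procedure_result[OF initial_state[OF p]]
  have "inj_on (chi n p) {1..n}"
    using result(3) chi_eq_procedure[OF p] by (metis (no_types, lifting) inj_on_def)
  moreover have "chi n p ` {1..n} \<subseteq> {1..n}"
    using result(2) chi_eq_procedure[OF p] by (meson image_subsetI ranI subsetD)
  ultimately show "bij_betw (chi n p) {1..n} {1..n}"
    by (simp add: bij_betw_def endo_inj_surj)
qed (use chi_outside(2)[OF p] in auto)

lemma run_tops_chi:
  assumes p: "p permutes {1..n}"
  shows "hd ` set (runs (one_line n p)) = {x \<in> {1..n}. chi n p x \<le> x}"
proof -
  let ?rs = "runs (one_line n p)"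
  note rs = runs_one_line[OF p]
  note f = excedance_part_chi_e[OF p]
  note result = chi_procedure_result[OF initial_state[OF p]]
  have "chi n p x \<le> x" if "x \<in> hd ` set ?rs" "x \<in> {1..n}" for x
    using result(5) chi_eq_procedure[OF p that(2)] that(1) by force
  moreover have "x < chi n p x" if "x \<notin> hd ` set ?rs" "x \<in> {1..n}" for x
  proof -
    have "x \<in> dom (chi_e n p)" using f that by (auto simp: excedance_part_def)
    then have "chi_e n p x = Some (chi n p x)"
      using result(4) chi_eq_procedure[OF p that(2)] by (auto simp: map_le_def)
    then show ?thesis by (rule excedance_part_less[OF rs f])
  qed
  ultimately show ?thesis
    using run_sequence_ends(1)[OF rs(1)] rs(2) by (auto simp: not_le[symmetric])
qed

lemma inj_on_chi: "inj_on (chi n) {p. p permutes {1..n}}"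
proof (rule inj_onI)
  fix p p' assume "p \<in> {p. p permutes {1..n}}" "p' \<in> {p. p permutes {1..n}}"
    and eq: "chi n p = chi n p'"
  then have p: "p permutes {1..n}" and p': "p' permutes {1..n}" by auto
  let ?rs = "runs (one_line n p)" and ?rs' = "runs (one_line n p')"
  note rs = runs_one_line[OF p] and rs' = runs_one_line[OF p']
  note f = excedance_part_chi_e[OF p] and f' = excedance_part_chi_e[OF p']
  have result: "chi_procedure n ?rs (chi_e n p) = chi_procedure n ?rs' (chi_e n p')"
  proof
    fix x show "chi_procedure n ?rs (chi_e n p) x = chi_procedure n ?rs' (chi_e n p') x"
      using chi_eq_procedure[OF p] chi_eq_procedure[OF p'] chi_outside(1)[OF p]
        chi_outside(1)[OF p'] eq by (cases "x \<in> {1..n}") auto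
  qed
  have tops: "hd ` set ?rs = hd ` set ?rs'"
    using run_tops_chi[OF p] run_tops_chi[OF p'] eq by simp
  have chi_e: "chi_e n p = chi_e n p'"
  proof
    fix x
    have dom: "dom (chi_e n p) = {1..n} - hd ` set ?rs" "dom (chi_e n p') = {1..n} - hd ` set ?rs"
      using f f' tops by (auto simp: excedance_part_def)
    show "chi_e n p x = chi_e n p' x"
    proof (cases "x \<in> {1..n} - hd ` set ?rs")
      case True
      then show ?thesis
        using chi_procedure_result(4)[OF initial_state[OF p]]
          chi_procedure_result(4)[OF initial_state[OF p']] dom result
        by (simp add: map_le_def)
    next
      case False
      then show ?thesis using dom by (metis domIff)
    qed
  qed
  have bots: "last ` set ?rs = last ` set ?rs'"
  proof -
    have "last ` set (runs (one_line n q)) = {1..n} - ran (chi_e n q)" if "q permutes {1..n}" for q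
      using excedance_part_chi_e[OF that] run_sequence_ends(2)[OF runs_one_line(1)[OF that]]
        runs_one_line(2)[OF that] by (auto simp: excedance_part_def)
    then show ?thesis using p p' chi_e by simp
  qed
  have "set ?rs = set ?rs'"
  proof (rule views_determine_runs[OF rs rs' tops bots])
    fix v assume "v \<in> {1..n} - last ` set ?rs"
    then show "views (set ?rs) v = views (set ?rs') v"
      using f f' bots chi_e unfolding excedance_part_def by metis
  qed
  then have "?rs = ?rs'"
    using chi_procedure_inject initial_state[OF p] initial_state[OF p'] result chi_e by simp
  then have "one_line n p = one_line n p'"
    by (metis concat_runs)
  then have "p x = p' x" if "x \<in> {1..n}" for x
    using that by (auto simp: one_line_def simp del: upt_Suc)
  then show "p = p'"
    using permutes_not_in[OF p] permutes_not_in[OF p'] by (intro ext) metis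
qed

theorem proposition4p6:
  fixes n :: nat
  assumes "0 < n"
  shows "inj_on (chi n) {p. p permutes {1..n}} \<and>
    bij_betw (chi n) {p. p permutes {1..n}} {p. p permutes {1..n}}"
proof
  show "inj_on (chi n) {p. p permutes {1..n}}" by (rule inj_on_chi)
  moreover have "finite {p. p permutes {1..n}}" by (intro finite_permutations) simp
  moreover have "chi n ` {p. p permutes {1..n}} \<subseteq> {p. p permutes {1..n}}"
    using chi_permutes by blast
  ultimately show "bij_betw (chi n) {p. p permutes {1..n}} {p. p permutes {1..n}}"
    by (simp add: bij_betw_def endo_inj_surj)
qed

end
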